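(* Let $d,n\in\mathbb N$. For $j\in\{1,\dots,n\}$ and $r\in\{1,\dots,d\}$ let $p_j,q_{j,r}\in[0,1]$ be such that $\sum_{r=1}^d q_{j,r}=1$ for all $j$ and $\lambda_r:=\sum_{j=1}^n p_jq_{j,r}>0$ for all $r$. Set $\lambda=\sum_{j=1}^n p_j$, let $e_r\in\mathbb R^d$ be the $r$-th standard unit vector, and let $$F=\prod_{j=1}^n\Bigl(\delta_0+p_j\sum_{r=1}^d q_{j,r}(\delta_{e_r}-\delta_0)\Bigr),\qquad G=\exp\Bigl(\sum_{r=1}^d\lambda_r(\delta_{e_r}-\delta_0)\Bigr)$$ be the corresponding probability measures on $\mathbb R^d$ (products and exponentials in the convolution sense). Let $J\subseteq\{1,\dots,d\}$, $y_j=\sum_{r\in J}q_{j,r}$ and $\widetilde p_j=p_jy_j$ for $j\in\{1,\dots,n\}$, and $\widetilde\lambda=\sum_{j=1}^n\widetilde p_j$. Then $$\|F-G\|\ \ge\ \Bigl\|\prod_{j=1}^n\bigl(\delta_0+\widetilde p_j(\delta_1-\delta_0)\bigr)-\mathrm{Po}(\widetilde\lambda)\Bigr\|\ \ge\ \frac17\min\Bigl\{\frac1{\widetilde\lambda},\,1\Bigr\}\sum_{j=1}^n\widetilde p_j^{\,2},$$ where the middle term is a norm of a signed measure on $\mathbb R$. In particular, $$\|F-G\|\ge\frac17\min\Bigl\{\frac1\lambda,\,1\Bigr\}\sum_{j=1}^n p_j^2$$ and $$\|F-G\|\ge\frac17\max_{r\in\{1,\dots,d\}}\Bigl(\min\Bigl\{\frac1{\lambda_r},\,1\Bigr\}\sum_{j=1}^n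 p_j^2q_{j,r}^2\Bigr).$$
   Context: $\delta_x$ is the Dirac measure at $x$. Products and powers of finite signed measures on $\mathbb R^d$ (resp. $\mathbb R$), with Borel $\sigma$-algebra, are convolutions, with empty products and zeroth powers equal to $\delta_0$; $\exp(V)=\sum_{m=0}^\infty V^m/m!$. $\|V\|=V^+(\mathbb R^d)+V^-(\mathbb R^d)$ (resp. on $\mathbb R$) is the total variation norm, where $V=V^+-V^-$ is the Hahn-Jordan decomposition. $\mathrm{Po}(t)=\exp(t(\delta_1-\delta_0))$ is the Poisson distribution with mean $t\in[0,\infty)$ (so $\mathrm{Po}(0)=\delta_0$). Convention: $\frac10=\infty$. *)

theory Defs
  imports "HOL-Probability.Probability"
begin

section \<open>Countably additive real set functions on the Borel sets\<close>

text \<open>Set functions vanish outside the Borel sets, so that equality of signed measures is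
  equality of functions.\<close>

definition countably_additive_real :: "('a::topological_space set \<Rightarrow> real) \<Rightarrow> bool" where
  "countably_additive_real V \<longleftrightarrow>
     (\<forall>A. A \<notin> sets borel \<longrightarrow> V A = 0) \<and>
     (\<forall>F :: nat \<Rightarrow> 'a set. range F \<subseteq> sets borel \<longrightarrow> disjoint_family F \<longrightarrow>
        (\<lambda>i. V (F i)) sums V (\<Union>i. F i))"

lemma car_notin: "countably_additive_real V \<Longrightarrow> A \<notin> sets borel \<Longrightarrow> V A = 0"
  by (auto simp: countably_additive_real_def)

lemma car_sums:
  assumes "countably_additive_real V" "\<And>i::nat. F i \<in> sets borel" "disjoint_family F"
  shows "(\<lambda>i. V (F i)) sums V (\<Union>i. F i)"
  using assms unfolding countably_additive_real_def by blast

lemma car_empty: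
  assumes "countably_additive_real V" shows "V {} = 0"
proof -
  have "(\<lambda>i::nat. V {}) sums V (\<Union>i::nat. {})"
    by (rule car_sums[OF assms]) (auto simp: disjoint_family_on_def)
  then have "(\<lambda>i::nat. V {}) \<longlonglongrightarrow> 0"
    by (intro summable_LIMSEQ_zero sums_summable)
  then show ?thesis by (simp add: LIMSEQ_const_iff)
qed

lemma car_Un:
  assumes V: "countably_additive_real V" and A: "A \<in> sets borel" and B: "B \<in> sets borel" and d: "A \<inter> B = {}"
  shows "V (A \<union> B) = V A + V B"
proof -
  have m: "\<And>i. binaryset A B i \<in> sets borel" using A B by (auto simp: binaryset_def)
  have dd: "disjoint_family (binaryset A B)"
    using d by (simp add: disjoint_family_on_def binaryset_def Int_commute)
  have "(\<lambda>i. V (binaryset A B i)) sums V (\<Union>i. binaryset A B i)"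
    by (rule car_sums[OF V m dd])
  moreover have "(\<lambda>i. V (binaryset A B i)) sums (\<Sum>i\<in>{0,1}. V (binaryset A B i))"
    by (rule sums_finite) (auto simp: binaryset_def car_empty[OF V])
  ultimately show ?thesis
    by (auto simp: UN_binaryset_eq binaryset_def dest: sums_unique2)
qed

lemma car_Diff:
  assumes V: "countably_additive_real V" and A: "A \<in> sets borel" and B: "B \<in> sets borel" and s: "B \<subseteq> A"
  shows "V (A - B) = V A - V B"
proof -
  have "V (B \<union> (A - B)) = V B + V (A - B)" using A B by (intro car_Un[OF V]) auto
  moreover have "B \<union> (A - B) = A" using s by auto
  ultimately show ?thesis by simp
qed

lemma car_Compl:
  assumes V: "countably_additive_real V" and A: "A \<in> sets borel"
  shows "V (- A) = V UNIV - V A"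
  using car_Diff[OF V, of UNIV A] A by (simp add: Compl_eq_Diff_UNIV)

lemma car_split:
  assumes V: "countably_additive_real V" and A: "A \<in> sets borel" and B: "B \<in> sets borel"
  shows "V A = V (A \<inter> B) + V (A - B)"
proof -
  have "V ((A \<inter> B) \<union> (A - B)) = V (A \<inter> B) + V (A - B)" using A B by (intro car_Un[OF V]) auto
  moreover have "(A \<inter> B) \<union> (A - B) = A" by auto
  ultimately show ?thesis by simp
qed

lemma car_modular:
  assumes V: "countably_additive_real V" and A: "A \<in> sets borel" and B: "B \<in> sets borel"
  shows "V (A \<inter> B) + V (A \<union> B) = V A + V B"
proof -
  have "V (A \<union> (B - A)) = V A + V (B - A)" using A B by (intro car_Un[OF V]) auto
  moreover have "A \<union> (B - A) = A \<union> B" by auto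
  moreover have "V B = V (B \<inter> A) + V (B - A)" by (rule car_split[OF V B A])
  ultimately show ?thesis by (simp add: Int_commute)
qed

lemma car_UN_finite:
  assumes V: "countably_additive_real V" and F: "\<And>i::nat. F i \<in> sets borel" and d: "disjoint_family F"
  shows "V (\<Union>i<n. F i) = (\<Sum>i<n. V (F i))"
proof (induction n)
  case 0 then show ?case by (simp add: car_empty[OF V])
next
  case (Suc n)
  have "V ((\<Union>i<n. F i) \<union> F n) = V (\<Union>i<n. F i) + V (F n)"
  proof (intro car_Un[OF V])
    have "F i \<inter> F n = {}" if "i < n" for i using d that by (auto simp: disjoint_family_on_def)
    then show "(\<Union>i<n. F i) \<inter> F n = {}" by blast
  qed (use F in auto)
  moreover have "(\<Union>i<Suc n. F i) = (\<Union>i<n. F i) \<union> F n"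
    by (auto simp: less_Suc_eq)
  ultimately show ?case using Suc by simp
qed

lemma car_incseq:
  assumes V: "countably_additive_real V" and F: "\<And>i::nat. F i \<in> sets borel" and inc: "incseq F"
  shows "(\<lambda>n. V (F n)) \<longlonglongrightarrow> V (\<Union>i. F i)"
proof -
  have m: "disjointed F i \<in> sets borel" for i
    using F by (intro sets.range_disjointed_sets[THEN subsetD, of F borel]) auto
  have "(\<lambda>i. V (disjointed F i)) sums V (\<Union>i. disjointed F i)"
    by (rule car_sums[OF V m disjoint_family_disjointed])
  then have "(\<lambda>n. \<Sum>i<Suc n. V (disjointed F i)) \<longlonglongrightarrow> V (\<Union>i. F i)"
    unfolding UN_disjointed_eq sums_def by (rule LIMSEQ_Suc)
  moreover have "(\<Sum>i<Suc n. V (disjointed F i)) = V (F n)" for n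
  proof -
    have "(\<Sum>i<Suc n. V (disjointed F i)) = V (\<Union>i<Suc n. disjointed F i)"
      by (rule car_UN_finite[OF V m disjoint_family_disjointed, symmetric])
    also have "(\<Union>i<Suc n. disjointed F i) = (\<Union>i<Suc n. F i)"
      using finite_UN_disjointed_eq[of F "Suc n"] by (simp add: atLeast0LessThan)
    also have "\<dots> = F n"
      using inc by (fastforce simp: incseq_def less_Suc_eq_le)
    finally show ?thesis .
  qed
  ultimately show ?thesis by simp
qed

lemma car_decseq:
  assumes V: "countably_additive_real V" and F: "\<And>i::nat. F i \<in> sets borel" and dec: "decseq F"
  shows "(\<lambda>n. V (F n)) \<longlonglongrightarrow> V (\<Inter>i. F i)"
proof -
  have m: "- F i \<in> sets borel" for i using F[of i] by (rule borel_comp)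
  have "(\<lambda>n. V (- F n)) \<longlonglongrightarrow> V (\<Union>i. - F i)"
    using dec by (intro car_incseq[OF V m]) (auto simp: decseq_def incseq_def)
  moreover have "(\<Union>i. - F i) = - (\<Inter>i. F i)" by auto
  moreover have I: "(\<Inter>i. F i) \<in> sets borel" using F by auto
  ultimately have "(\<lambda>n. V UNIV - V (F n)) \<longlonglongrightarrow> V UNIV - V (\<Inter>i. F i)"
    by (simp only: car_Compl[OF V F] car_Compl[OF V I])
  from tendsto_diff[OF tendsto_const[of "V UNIV"] this] show ?thesis by simp
qed

lemma car_bounded:
  fixes V :: "'a::topological_space set \<Rightarrow> real"
  assumes V: "countably_additive_real V"
  shows "\<exists>C. \<forall>A. \<bar>V A\<bar> \<le> C"
proof (rule ccontr)
  define U where "U E \<longleftrightarrow> E \<in> sets borel \<and> (\<forall>C. \<exists>A\<in>sets borel. A \<subseteq> E \<and> \<bar>V A\<bar> > C)" for E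
  assume "\<not> (\<exists>C. \<forall>A. \<bar>V A\<bar> \<le> C)"
  then have unb: "\<And>C. \<exists>A. C < \<bar>V A\<bar>" by (auto simp: not_le)
  have "\<exists>A\<in>sets borel. C < \<bar>V A\<bar>" for C
  proof -
    obtain A where A: "max C 0 < \<bar>V A\<bar>" using unb by blast
    then have "A \<in> sets borel" using car_notin[OF V, of A] by force
    then show ?thesis using A by auto
  qed
  then have U0: "U UNIV" by (auto simp: U_def)
  have split: "\<exists>G. U G \<and> G \<subseteq> E \<and> 1 \<le> \<bar>V (E - G)\<bar>" if E: "U E" for E
  proof -
    have Eb: "E \<in> sets borel" using E by (simp add: U_def)
    obtain A where A: "A \<in> sets borel" "A \<subseteq> E" "\<bar>V A\<bar> > \<bar>V E\<bar> + 1"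
      using E by (auto simp: U_def)
    have D: "V (E - A) = V E - V A" by (rule car_Diff[OF V Eb A(1,2)])
    have "U A \<or> U (E - A)"
    proof (rule ccontr)
      assume "\<not> ?thesis"
      then have nU: "\<not> U A" "\<not> U (E - A)" by blast+
      have "E - A \<in> sets borel" using A(1) Eb by simp
      obtain C1 where C1: "\<And>B. B \<in> sets borel \<Longrightarrow> B \<subseteq> A \<Longrightarrow> \<bar>V B\<bar> \<le> C1"
        using nU(1) A(1) unfolding U_def not_less[symmetric] by blast
      obtain C2 where C2: "\<And>B. B \<in> sets borel \<Longrightarrow> B \<subseteq> E - A \<Longrightarrow> \<bar>V B\<bar> \<le> C2"
        using nU(2) \<open>E - A \<in> sets borel\<close> unfolding U_def not_less[symmetric] by blast
      obtain B where B: "B \<in> sets borel" "B \<subseteq> E" "\<bar>V B\<bar> > C1 + C2"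
        using E by (auto simp: U_def)
      have "V B = V (B \<inter> A) + V (B - A)" by (rule car_split[OF V B(1) A(1)])
      moreover have "\<bar>V (B \<inter> A)\<bar> \<le> C1" using A B by (intro C1) auto
      moreover have "\<bar>V (B - A)\<bar> \<le> C2" using A B by (intro C2) auto
      ultimately show False using B(3) by linarith
    qed
    then show ?thesis
    proof
      assume "U A" moreover have "1 \<le> \<bar>V (E - A)\<bar>" using D A(3) by linarith
      ultimately show ?thesis using A by blast
    next
      assume "U (E - A)" moreover have "E - (E - A) = A" using A by auto
      moreover have "1 \<le> \<bar>V A\<bar>" using A(3) by linarith
      ultimately show ?thesis by (intro exI[of _ "E - A"]) auto
    qed
  qed
  then obtain g where g: "\<And>E. U E \<Longrightarrow> U (g E) \<and> g E \<subseteq> E \<and> 1 \<le> \<bar>V (E - g E)\<bar>" by metis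
  define E where "E n = (g ^^ n) UNIV" for n
  have UE: "U (E n)" for n by (induction n) (auto simp: E_def U0 g)
  have ES: "E (Suc n) = g (E n)" for n by (simp add: E_def)
  have dec: "decseq E" using g UE by (intro decseq_SucI) (auto simp: ES)
  define F where "F n = E n - E (Suc n)" for n
  have Fb: "F n \<in> sets borel" for n using UE by (auto simp: F_def U_def)
  have "F m \<inter> F n = {}" if "m < n" for m n
    using decseqD[OF dec, of "Suc m" n] that by (auto simp: F_def)
  then have "disjoint_family F"
    unfolding disjoint_family_on_def by (metis Int_commute linorder_neqE_nat)
  then have "(\<lambda>n. V (F n)) sums V (\<Union>n. F n)" by (intro car_sums[OF V Fb])
  then have "(\<lambda>n. V (F n)) \<longlonglongrightarrow> 0" by (intro summable_LIMSEQ_zero sums_summable)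
  then have "eventually (\<lambda>n. \<bar>V (F n)\<bar> < 1) sequentially"
    by (auto dest!: tendstoD[of _ _ _ 1])
  then obtain n where "\<bar>V (F n)\<bar> < 1" by (auto simp: eventually_sequentially)
  moreover have "1 \<le> \<bar>V (F n)\<bar>" using g[OF UE[of n]] by (simp add: F_def ES)
  ultimately show False by simp
qed

definition is_hahn_set :: "('a::topological_space set \<Rightarrow> real) \<Rightarrow> 'a set \<Rightarrow> bool" where
  "is_hahn_set V P \<longleftrightarrow> P \<in> sets borel \<and>
     (\<forall>A\<in>sets borel. A \<subseteq> P \<longrightarrow> 0 \<le> V A) \<and>
     (\<forall>A\<in>sets borel. A \<inter> P = {} \<longrightarrow> V A \<le> 0)"

theorem Hahn_decomposition_exists:
  fixes V :: "'a::topological_space set \<Rightarrow> real"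
  assumes V: "countably_additive_real V"
  shows "\<exists>P. is_hahn_set V P"
proof -
  have bdd: "bdd_above (V ` sets borel)"
  proof -
    obtain C where "\<And>A. \<bar>V A\<bar> \<le> C" using car_bounded[OF V] by blast
    then show ?thesis by (intro bdd_aboveI2[where M=C]) (meson abs_le_D1)
  qed
  define s where "s = (SUP A\<in>sets borel. V A)"
  have le_s: "V A \<le> s" if "A \<in> sets borel" for A
    unfolding s_def by (rule cSUP_upper[OF that bdd])
  have "\<exists>A\<in>sets borel. s - 1 / 2^n < V A" for n :: nat
    unfolding s_def by (intro less_cSUP_iff[THEN iffD1] bdd) auto
  then obtain E where Eb: "\<And>n::nat. E n \<in> sets borel" and E: "\<And>n. V (E n) > s - 1 / 2^n"
    by metis
  define D where "D n m = (\<Inter>k\<in>{n..n+m}. E k)" for n m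
  have Db: "D n m \<in> sets borel" for n m using Eb by (auto simp: D_def)
  have D_Suc: "D n (Suc m) = D n m \<inter> E (n + Suc m)" for n m
    by (auto simp: D_def le_Suc_eq)
  have D_ge: "V (D n m) \<ge> s - 2 / 2^n + 1 / 2^(n+m)" for n m
  proof (induction m)
    case 0 then show ?case using E[of n] by (simp add: D_def)
  next
    case (Suc m)
    have "V (D n (Suc m)) = V (D n m) + V (E (n + Suc m)) - V (D n m \<union> E (n + Suc m))"
      using car_modular[OF V Db Eb, of n m "n + Suc m"] by (simp add: D_Suc)
    moreover have "V (D n m \<union> E (n + Suc m)) \<le> s" using Db Eb by (intro le_s) auto
    moreover have "V (E (n + Suc m)) > s - 1 / 2^(n + Suc m)" by (rule E)
    moreover have "1 / 2^(n + m) - 1 / 2^(n + Suc m) = (1 / 2^(n + Suc m) :: real)"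
      by (simp add: field_simps)
    ultimately show ?case using Suc by linarith
  qed
  define B where "B n = (\<Inter>m. D n m)" for n
  have Bb: "B n \<in> sets borel" for n using Db by (auto simp: B_def)
  have B_eq: "B n = (\<Inter>k\<in>{n..}. E k)" for n
  proof -
    have "E k \<supseteq> B n" if "n \<le> k" for k
      unfolding B_def D_def using that by (auto intro!: bexI[of _ k] elim!: allE[of _ "k - n"])
    then show ?thesis unfolding B_def D_def by auto
  qed
  have B_ge: "s - 2 / 2^n \<le> V (B n)" for n
  proof (rule LIMSEQ_le_const)
    show "(\<lambda>m. V (D n m)) \<longlonglongrightarrow> V (B n)" unfolding B_def
      by (rule car_decseq[OF V Db]) (auto simp: decseq_def D_def)
    show "\<exists>N. \<forall>m\<ge>N. s - 2 / 2^n \<le> V (D n m)"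
    proof (intro exI allI impI)
      fix m
      have "(0::real) \<le> 1 / 2^(n+m)" by simp
      then show "s - 2 / 2^n \<le> V (D n m)" using D_ge[of n m] by linarith
    qed
  qed
  define P where "P = (\<Union>n. B n)"
  have Pb: "P \<in> sets borel" using Bb by (auto simp: P_def)
  have lim1: "(\<lambda>n. s - 2 / 2^n) \<longlonglongrightarrow> s - 0"
    by (intro tendsto_intros LIMSEQ_divide_realpow_zero) auto
  have lim2: "(\<lambda>n. V (B n)) \<longlonglongrightarrow> V P"
    unfolding P_def by (rule car_incseq[OF V Bb]) (auto simp: incseq_def B_eq)
  have P_ge: "s \<le> V P" using LIMSEQ_le[OF lim1 lim2] B_ge by auto
  have "is_hahn_set V P"
    unfolding is_hahn_set_def
  proof (intro conjI ballI impI Pb)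
    fix A assume A: "A \<in> sets borel" "A \<subseteq> P"
    have "V (P - A) = V P - V A" by (rule car_Diff[OF V Pb A])
    moreover have "V (P - A) \<le> s" using A Pb by (intro le_s) auto
    ultimately show "0 \<le> V A" using P_ge by linarith
  next
    fix A assume A: "A \<in> sets borel" "A \<inter> P = {}"
    have "V (A \<union> P) = V A + V P" by (rule car_Un[OF V A(1) Pb A(2)])
    moreover have "V (A \<union> P) \<le> s" using A Pb by (intro le_s) auto
    ultimately show "V A \<le> 0" using P_ge by linarith
  qed
  then show ?thesis by blast
qed

lemma car_measure_diff:
  fixes M N :: "'a::topological_space measure"
  assumes "finite_measure M" "finite_measure N" and sM: "sets M = sets borel" and sN: "sets N = sets borel"
  shows "countably_additive_real (\<lambda>A. measure M A - measure N A)"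
proof -
  interpret M: finite_measure M by fact
  interpret N: finite_measure N by fact
  show ?thesis
    unfolding countably_additive_real_def
    using sM sN by (auto intro!: sums_diff M.finite_measure_UNION N.finite_measure_UNION simp: measure_notin_sets)
qed

lemma car_lin:
  assumes "countably_additive_real V" "countably_additive_real W"
  shows "countably_additive_real (\<lambda>A. a * V A + b * W A)"
  using assms unfolding countably_additive_real_def by (auto intro!: sums_add sums_mult)

lemma car_limit:
  fixes X :: "nat \<Rightarrow> 'a::topological_space set \<Rightarrow> real"
  assumes X: "\<And>n. countably_additive_real (X n)"
    and u: "\<And>e. e > 0 \<Longrightarrow> \<exists>N. \<forall>n\<ge>N. \<forall>A. \<bar>X n A - L A\<bar> \<le> e"
  shows "countably_additive_real L"
proof -
  have lim: "(\<lambda>n. X n A) \<longlonglongrightarrow> L A" for A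
  proof (rule LIMSEQ_I)
    fix r :: real assume "0 < r"
    then obtain N where "\<forall>n\<ge>N. \<forall>A. \<bar>X n A - L A\<bar> \<le> r/2" using u[of "r/2"] by auto
    then have "\<forall>n\<ge>N. norm (X n A - L A) \<le> r/2" by simp
    moreover have "r/2 < r" using \<open>0 < r\<close> by simp
    ultimately show "\<exists>N. \<forall>n\<ge>N. norm (X n A - L A) < r" by (meson le_less_trans)
  qed
  show ?thesis
    unfolding countably_additive_real_def
  proof (intro conjI allI impI)
    fix A :: "'a set" assume "A \<notin> sets borel"
    then have "(\<lambda>n. X n A) = (\<lambda>n. 0)" using car_notin[OF X] by auto
    then show "L A = 0" using lim[of A] by (simp add: LIMSEQ_const_iff)
  next
    fix F :: "nat \<Rightarrow> 'a set" assume r: "range F \<subseteq> sets borel" and d: "disjoint_family F"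
    then have Fb: "\<And>i. F i \<in> sets borel" by auto
    have fin: "L (\<Union>i<k. F i) = (\<Sum>i<k. L (F i))" for k
    proof (rule LIMSEQ_unique[OF lim])
      have "(\<lambda>n. \<Sum>i<k. X n (F i)) \<longlonglongrightarrow> (\<Sum>i<k. L (F i))" by (intro tendsto_sum lim)
      then show "(\<lambda>n. X n (\<Union>i<k. F i)) \<longlonglongrightarrow> (\<Sum>i<k. L (F i))"
        by (simp add: car_UN_finite[OF X Fb d])
    qed
    show "(\<lambda>i. L (F i)) sums L (\<Union>i. F i)"
      unfolding sums_def
    proof (rule LIMSEQ_I)
      fix r :: real assume "0 < r"
      then obtain N where N: "\<And>A. \<bar>X N A - L A\<bar> \<le> r/3" using u[of "r/3"] by auto
      have "(\<lambda>k. \<Sum>i<k. X N (F i)) \<longlonglongrightarrow> X N (\<Union>i. F i)"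
        using car_sums[OF X Fb d] by (simp add: sums_def)
      from LIMSEQ_D[OF this, of "r/3"] \<open>0 < r\<close>
      obtain K where K: "\<And>k. k \<ge> K \<Longrightarrow> \<bar>(\<Sum>i<k. X N (F i)) - X N (\<Union>i. F i)\<bar> < r/3"
        unfolding real_norm_def by (metis zero_less_divide_iff zero_less_numeral)
      show "\<exists>K. \<forall>k\<ge>K. norm ((\<Sum>i<k. L (F i)) - L (\<Union>i. F i)) < r"
      proof (intro exI[of _ K] allI impI)
        fix k assume "K \<le> k"
        have "\<bar>X N (\<Union>i<k. F i) - X N (\<Union>i. F i)\<bar> < r/3"
          using K[OF \<open>K \<le> k\<close>] by (simp add: car_UN_finite[OF X Fb d])
        moreover have "\<bar>X N (\<Union>i<k. F i) - L (\<Union>i<k. F i)\<bar> \<le> r/3" by (rule N)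
        moreover have "\<bar>X N (\<Union>i. F i) - L (\<Union>i. F i)\<bar> \<le> r/3" by (rule N)
        ultimately show "norm ((\<Sum>i<k. L (F i)) - L (\<Union>i. F i)) < r"
          unfolding fin[symmetric] real_norm_def by linarith
      qed
    qed
  qed
qed


section \<open>Finite signed Borel measures\<close>

typedef (overloaded) 'a signed_measure =
    "{V :: 'a::topological_space set \<Rightarrow> real. countably_additive_real V}"
  morphisms smeasure Abs_signed_measure
  by (rule exI[of _ "\<lambda>_. 0"]) (simp add: countably_additive_real_def)

setup_lifting type_definition_signed_measure

lemma car_smeasure [simp]: "countably_additive_real (smeasure V)"
  using smeasure[of V] by simp

lemma smeasure_notin: "A \<notin> sets borel \<Longrightarrow> smeasure V A = 0"
  by (rule car_notin[OF car_smeasure])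

lemma signed_measure_eqI: "(\<And>A. A \<in> sets borel \<Longrightarrow> smeasure V A = smeasure W A) \<Longrightarrow> V = W"
  by (metis smeasure_inject smeasure_notin ext)

instantiation signed_measure :: (topological_space) real_vector
begin

lift_definition zero_signed_measure :: "'a signed_measure" is "\<lambda>_. 0"
  by (simp add: countably_additive_real_def)

lift_definition plus_signed_measure :: "'a signed_measure \<Rightarrow> 'a signed_measure \<Rightarrow> 'a signed_measure"
  is "\<lambda>V W A. V A + W A"
  using car_lin[where a = 1 and b = 1] by simp

lift_definition uminus_signed_measure :: "'a signed_measure \<Rightarrow> 'a signed_measure"
  is "\<lambda>V A. - V A"
  using car_lin[where a = "- 1" and b = 0] by simp

lift_definition minus_signed_measure :: "'a signed_measure \<Rightarrow> 'a signed_measure \<Rightarrow> 'a signed_measure"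
  is "\<lambda>V W A. V A - W A"
  using car_lin[where a = 1 and b = "- 1"] by simp

lift_definition scaleR_signed_measure :: "real \<Rightarrow> 'a signed_measure \<Rightarrow> 'a signed_measure"
  is "\<lambda>c V A. c * V A"
  using car_lin[where b = 0] by simp

instance
  by standard (transfer, force simp: algebra_simps)+

end

lemma smeasure_simps [simp]:
  "smeasure 0 A = 0"
  "smeasure (V + W) A = smeasure V A + smeasure W A"
  "smeasure (V - W) A = smeasure V A - smeasure W A"
  "smeasure (- V) A = - smeasure V A"
  "smeasure (c *\<^sub>R V) A = c * smeasure V A"
  by (transfer, simp)+

lemma smeasure_sum [simp]: "smeasure (sum f I) A = (\<Sum>i\<in>I. smeasure (f i) A)"
  by (induction I rule: infinite_finite_induct) auto


subsection \<open>Jordan decomposition and total variation norm\<close>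

text \<open>Two Hahn sets of the same measure differ by a set all of whose Borel subsets have measure 0,
  so the positive and negative parts below do not depend on the choice.\<close>

definition hahn_set :: "'a::topological_space signed_measure \<Rightarrow> 'a set" where
  "hahn_set V = (SOME P. is_hahn_set (smeasure V) P)"

definition jordan_pos :: "'a::topological_space signed_measure \<Rightarrow> 'a measure" where
  "jordan_pos V = measure_of UNIV (sets borel) (\<lambda>A. ennreal (smeasure V (A \<inter> hahn_set V)))"

definition jordan_neg :: "'a::topological_space signed_measure \<Rightarrow> 'a measure" where
  "jordan_neg V = measure_of UNIV (sets borel) (\<lambda>A. ennreal (- smeasure V (A - hahn_set V)))"

lemma hahn_set: "is_hahn_set (smeasure V) (hahn_set V)"
  unfolding hahn_set_def by (rule someI_ex[OF Hahn_decomposition_exists[OF car_smeasure]])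

lemma hahn_set_borel [simp, measurable]: "hahn_set V \<in> sets borel"
  using hahn_set[of V] by (simp add: is_hahn_set_def)

lemma hahn_set_pos: "A \<in> sets borel \<Longrightarrow> 0 \<le> smeasure V (A \<inter> hahn_set V)"
  using hahn_set[of V] by (simp add: is_hahn_set_def)

lemma hahn_set_neg: "A \<in> sets borel \<Longrightarrow> smeasure V (A - hahn_set V) \<le> 0"
  using hahn_set[of V] by (auto simp: is_hahn_set_def)

lemma space_jordan [simp]: "space (jordan_pos V) = UNIV" "space (jordan_neg V) = UNIV"
  by (simp_all add: jordan_pos_def jordan_neg_def space_measure_of_conv)

lemma sets_jordan [simp, measurable_cong]:
  "sets (jordan_pos V) = sets borel" "sets (jordan_neg V) = sets borel"
  using sets.sigma_sets_eq[of borel] by (simp_all add: jordan_pos_def jordan_neg_def)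

lemma emeasure_measure_of_car:
  fixes V :: "'a::topological_space set \<Rightarrow> real"
  assumes V: "\<And>F. (\<And>i::nat. F i \<in> sets borel) \<Longrightarrow> disjoint_family F \<Longrightarrow> (\<lambda>i. V (F i)) sums V (\<Union>i. F i)"
    and e: "V {} = 0" and pos: "\<And>A. A \<in> sets borel \<Longrightarrow> 0 \<le> V A" and A: "A \<in> sets borel"
  shows "emeasure (measure_of UNIV (sets borel) (\<lambda>A. ennreal (V A))) A = ennreal (V A)"
proof (rule emeasure_measure_of_sigma[OF _ _ _ A])
  show "sigma_algebra UNIV (sets (borel :: 'a measure))"
    using sets.sigma_algebra_axioms[of borel] by simp
  show "positive (sets borel) (\<lambda>A. ennreal (V A))" by (simp add: positive_def e)
  show "countably_additive (sets borel) (\<lambda>A. ennreal (V A))"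
  proof (rule countably_additiveI)
    fix F :: "nat \<Rightarrow> 'a set" assume F: "range F \<subseteq> sets borel" and d: "disjoint_family F"
    then have "(\<lambda>i. V (F i)) sums V (\<Union>i. F i)" by (intro V) auto
    then show "(\<Sum>i. ennreal (V (F i))) = ennreal (V (\<Union>i. F i))"
      using F pos by (subst suminf_ennreal2) (auto simp: sums_iff)
  qed
qed

lemma emeasure_jordan_pos: 
  assumes A: "A \<in> sets borel"
  shows "emeasure (jordan_pos V) A = ennreal (smeasure V (A \<inter> hahn_set V))"
  unfolding jordan_pos_def
proof (rule emeasure_measure_of_car[OF _ _ _ A])
  fix F :: "nat \<Rightarrow> 'a set" assume F: "\<And>i. F i \<in> sets borel" and d: "disjoint_family F"
  have "(\<lambda>i. smeasure V (F i \<inter> hahn_set V)) sums smeasure V (\<Union>i. F i \<inter> hahn_set V)"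
    using F d by (intro car_sums) (auto simp: disjoint_family_on_def)
  then show "(\<lambda>i. smeasure V (F i \<inter> hahn_set V)) sums smeasure V ((\<Union>i. F i) \<inter> hahn_set V)"
    by simp
qed (auto simp: car_empty hahn_set_pos)

lemma emeasure_jordan_neg: 
  assumes A: "A \<in> sets borel"
  shows "emeasure (jordan_neg V) A = ennreal (- smeasure V (A - hahn_set V))"
  unfolding jordan_neg_def
proof (rule emeasure_measure_of_car[OF _ _ _ A])
  fix F :: "nat \<Rightarrow> 'a set" assume F: "\<And>i. F i \<in> sets borel" and d: "disjoint_family F"
  have "(\<lambda>i. smeasure V (F i - hahn_set V)) sums smeasure V (\<Union>i. F i - hahn_set V)"
    using F d by (intro car_sums) (auto simp: disjoint_family_on_def)
  then show "(\<lambda>i. - smeasure V (F i - hahn_set V)) sums - smeasure V ((\<Union>i. F i) - hahn_set V)"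
    by (simp add: sums_minus)
qed (auto simp: car_empty hahn_set_neg)

lemma measure_jordan_pos: "A \<in> sets borel \<Longrightarrow> measure (jordan_pos V) A = smeasure V (A \<inter> hahn_set V)"
  by (simp add: measure_def emeasure_jordan_pos hahn_set_pos)

lemma measure_jordan_neg: "A \<in> sets borel \<Longrightarrow> measure (jordan_neg V) A = - smeasure V (A - hahn_set V)"
  by (simp add: measure_def emeasure_jordan_neg hahn_set_neg)

lemma finite_jordan [simp]: "finite_measure (jordan_pos V)" "finite_measure (jordan_neg V)"
  by (auto intro!: finite_measureI simp: emeasure_jordan_pos emeasure_jordan_neg)

theorem jordan_decomposition: "smeasure V A = measure (jordan_pos V) A - measure (jordan_neg V) A"
proof (cases "A \<in> sets borel")
  case True
  then show ?thesis
    using car_split[OF car_smeasure True hahn_set_borel[of V], of V]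
    by (simp add: measure_jordan_pos measure_jordan_neg)
qed (simp add: smeasure_notin measure_notin_sets)

theorem jordan_mutually_singular:
  "measure (jordan_pos V) (- hahn_set V) = 0" "measure (jordan_neg V) (hahn_set V) = 0"
  by (simp_all add: measure_jordan_pos measure_jordan_neg car_empty borel_comp)

instantiation signed_measure :: (topological_space) real_normed_vector
begin

definition norm_signed_measure :: "'a signed_measure \<Rightarrow> real" where
  "norm V = measure (jordan_pos V) UNIV + measure (jordan_neg V) UNIV"

definition dist_signed_measure :: "'a signed_measure \<Rightarrow> 'a signed_measure \<Rightarrow> real" where
  "dist_signed_measure V W = norm (V - W)"

definition sgn_signed_measure :: "'a signed_measure \<Rightarrow> 'a signed_measure" where
  "sgn_signed_measure V = V /\<^sub>R norm V"

definition uniformity_signed_measure :: "('a signed_measure \<times> 'a signed_measure) filter" where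
  "uniformity_signed_measure = (INF e\<in>{0 <..}. principal {(x, y). dist x y < e})"

definition open_signed_measure :: "'a signed_measure set \<Rightarrow> bool" where
  "open_signed_measure S = (\<forall>x\<in>S. \<forall>\<^sub>F (x', y) in uniformity. x' = x \<longrightarrow> y \<in> S)"

lemma norm_hahn: "norm V = smeasure V (hahn_set V) - smeasure V (- hahn_set V)"
  by (simp add: norm_signed_measure_def measure_jordan_pos measure_jordan_neg Compl_eq_Diff_UNIV)

lemma norm_smeasure_ge:
  assumes A: "A \<in> sets borel"
  shows "smeasure V A - smeasure V (- A) \<le> norm V"
proof -
  interpret P: finite_measure "jordan_pos V" by simp
  interpret N: finite_measure "jordan_neg V" by simp
  have c: "- A \<in> sets borel" using A by (rule borel_comp)
  have "measure (jordan_pos V) UNIV = measure (jordan_pos V) A + measure (jordan_pos V) (- A)"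
    using P.finite_measure_compl[of A] A by (simp add: Compl_eq_Diff_UNIV)
  moreover have "measure (jordan_neg V) UNIV = measure (jordan_neg V) A + measure (jordan_neg V) (- A)"
    using N.finite_measure_compl[of A] A by (simp add: Compl_eq_Diff_UNIV)
  ultimately show ?thesis
    unfolding norm_signed_measure_def jordan_decomposition[of V A] jordan_decomposition[of V "- A"]
    by (smt (verit) measure_nonneg)
qed

lemma abs_smeasure_le_norm: "\<bar>smeasure V A\<bar> \<le> norm V"
proof (cases "A \<in> sets borel")
  case True
  have "measure (jordan_pos V) A \<le> measure (jordan_pos V) UNIV"
    using finite_measure.bounded_measure[of "jordan_pos V" A] by simp
  moreover have "measure (jordan_neg V) A \<le> measure (jordan_neg V) UNIV"
    using finite_measure.bounded_measure[of "jordan_neg V" A] by simp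
  ultimately show ?thesis
    unfolding norm_signed_measure_def jordan_decomposition[of V A]
    by (smt (verit) measure_nonneg)
qed (simp add: smeasure_notin norm_signed_measure_def)

lemma norm_scaleR_le: "norm (c *\<^sub>R V) \<le> \<bar>c\<bar> * norm V" for V :: "'a signed_measure"
proof -
  let ?P = "hahn_set (c *\<^sub>R V)"
  have "smeasure V ?P - smeasure V (- ?P) \<le> norm V"
    by (rule norm_smeasure_ge) simp
  moreover have "smeasure V (- ?P) - smeasure V ?P \<le> norm V"
    using norm_smeasure_ge[of "- ?P" V] by (simp add: borel_comp)
  ultimately have "\<bar>smeasure V ?P - smeasure V (- ?P)\<bar> \<le> norm V" by linarith
  then have "\<bar>c\<bar> * \<bar>smeasure V ?P - smeasure V (- ?P)\<bar> \<le> \<bar>c\<bar> * norm V"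
    by (rule mult_left_mono) simp
  moreover have "norm (c *\<^sub>R V) = c * (smeasure V ?P - smeasure V (- ?P))"
    by (simp add: norm_hahn[of "c *\<^sub>R V"] right_diff_distrib)
  ultimately show ?thesis by (metis abs_ge_self abs_mult order_trans)
qed

instance
proof
  fix V W :: "'a signed_measure" and c :: real
  show "dist V W = norm (V - W)" by (rule dist_signed_measure_def)
  show "sgn V = V /\<^sub>R norm V" by (rule sgn_signed_measure_def)
  show "(uniformity :: ('a signed_measure \<times> 'a signed_measure) filter)
      = (INF e\<in>{0 <..}. principal {(x, y). dist x y < e})"
    by (rule uniformity_signed_measure_def)
  show "open U = (\<forall>x\<in>U. \<forall>\<^sub>F (x', y) in uniformity. x' = x \<longrightarrow> y \<in> U)"
    for U :: "'a signed_measure set"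
    by (rule open_signed_measure_def)
  show "norm V = 0 \<longleftrightarrow> V = 0"
  proof
    assume "norm V = 0"
    then have "smeasure V A = 0" for A using abs_smeasure_le_norm[of V A] by simp
    then show "V = 0" by (intro signed_measure_eqI) simp
  next
    assume "V = 0" then show "norm V = 0" by (simp add: norm_hahn)
  qed
  let ?P = "hahn_set (V + W)"
  have "norm (V + W) = (smeasure V ?P - smeasure V (- ?P)) + (smeasure W ?P - smeasure W (- ?P))"
    by (simp add: norm_hahn[of "V + W"])
  also have "\<dots> \<le> norm V + norm W"
    by (intro add_mono norm_smeasure_ge) simp_all
  finally show "norm (V + W) \<le> norm V + norm W" .
  show "norm (c *\<^sub>R V) = \<bar>c\<bar> * norm V"
  proof (cases "c = 0")
    case True then show ?thesis by (simp add: norm_hahn)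
  next
    case False
    have "norm V = norm (inverse c *\<^sub>R (c *\<^sub>R V))" using False by simp
    also have "\<dots> \<le> \<bar>inverse c\<bar> * norm (c *\<^sub>R V)" by (rule norm_scaleR_le)
    finally have "\<bar>c\<bar> * norm V \<le> norm (c *\<^sub>R V)"
      using False by (simp add: field_simps)
    then show ?thesis using norm_scaleR_le[of c V] by simp
  qed
qed

end

instance signed_measure :: (topological_space) banach
proof
  fix X :: "nat \<Rightarrow> 'a signed_measure" assume C: "Cauchy X"
  have ex: "\<exists>M. \<forall>m\<ge>M. \<forall>n\<ge>M. \<forall>A. \<bar>smeasure (X m) A - smeasure (X n) A\<bar> < e" if e: "e > 0" for e
  proof -
    obtain M where M: "\<And>m n. m \<ge> M \<Longrightarrow> n \<ge> M \<Longrightarrow> norm (X m - X n) < e"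
      using CauchyD[OF C e] by blast
    have "\<bar>smeasure (X m) A - smeasure (X n) A\<bar> \<le> norm (X m - X n)" for m n A
      using abs_smeasure_le_norm[of "X m - X n" A] by simp
    then show ?thesis using M by (meson le_less_trans)
  qed
  have "convergent (\<lambda>n. smeasure (X n) A)" for A
    unfolding Cauchy_convergent_iff[symmetric]
    using ex by (intro CauchyI) (metis real_norm_def)
  then obtain L where L: "\<And>A. (\<lambda>n. smeasure (X n) A) \<longlonglongrightarrow> L A"
    unfolding convergent_def by metis
  have u: "\<exists>N. \<forall>n\<ge>N. \<forall>A. \<bar>smeasure (X n) A - L A\<bar> \<le> e" if e: "e > 0" for e
  proof -
    obtain M where M: "\<And>m n A. m \<ge> M \<Longrightarrow> n \<ge> M \<Longrightarrow> \<bar>smeasure (X m) A - smeasure (X n) A\<bar> < e"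
      using ex[OF e] by blast
    have "\<bar>smeasure (X m) A - L A\<bar> \<le> e" if m: "m \<ge> M" for m A
    proof (rule LIMSEQ_le_const2)
      show "(\<lambda>n. \<bar>smeasure (X m) A - smeasure (X n) A\<bar>) \<longlonglongrightarrow> \<bar>smeasure (X m) A - L A\<bar>"
        by (intro tendsto_intros L)
      show "\<exists>N. \<forall>n\<ge>N. \<bar>smeasure (X m) A - smeasure (X n) A\<bar> \<le> e"
        using M[OF m] by (meson less_imp_le)
    qed
    then show ?thesis by blast
  qed
  have "countably_additive_real L" by (rule car_limit[OF car_smeasure u])
  then obtain Y where Y: "smeasure Y = L" by (metis Abs_signed_measure_inverse mem_Collect_eq)
  have "X \<longlonglongrightarrow> Y"
  proof (rule LIMSEQ_I)
    fix r :: real assume r: "0 < r"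
    then obtain N where N: "\<And>n A. n \<ge> N \<Longrightarrow> \<bar>smeasure (X n) A - L A\<bar> \<le> r/3" using u[of "r/3"] by auto
    have "norm (X n - Y) < r" if n: "n \<ge> N" for n
      using N[OF n, of "hahn_set (X n - Y)"] N[OF n, of "- hahn_set (X n - Y)"] r
      unfolding norm_hahn[of "X n - Y"] smeasure_simps Y by linarith
    then show "\<exists>N. \<forall>n\<ge>N. norm (X n - Y) < r" by blast
  qed
  then show "convergent X" by (auto simp: convergent_def)
qed


subsection \<open>Convolution algebra\<close>

lemma measurable_measure_translate:
  fixes M :: "'a::ordered_euclidean_space measure"
  assumes M: "finite_measure M" and sM [measurable_cong]: "sets M = sets borel"
    and A [measurable]: "A \<in> sets borel"
  shows "(\<lambda>x. measure M {a. a + x \<in> A}) \<in> borel_measurable borel"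
proof -
  interpret finite_measure M by fact
  have spM: "space M = UNIV" using sets_eq_imp_space_eq[OF sM] by simp
  have Q: "{z \<in> space (borel \<Otimes>\<^sub>M M). snd z + fst z \<in> A} \<in> sets (borel \<Otimes>\<^sub>M M)"
    by measurable
  have "(\<lambda>x. emeasure M (Pair x -` {z \<in> space (borel \<Otimes>\<^sub>M M). snd z + fst z \<in> A})) \<in> borel_measurable borel"
    by (rule measurable_emeasure_Pair[OF Q])
  moreover have "Pair x -` {z \<in> space (borel \<Otimes>\<^sub>M M). snd z + fst z \<in> A} = {a. a + x \<in> A}" for x
    by (auto simp: space_pair_measure spM)
  ultimately have "(\<lambda>x. emeasure M {a. a + x \<in> A}) \<in> borel_measurable borel" by simp
  then show ?thesis unfolding measure_def by measurable
qed

lemma integrable_measure_translate: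
  fixes M K :: "'a::ordered_euclidean_space measure"
  assumes M: "finite_measure M" and sM: "sets M = sets borel"
    and K: "finite_measure K" and sK [measurable_cong]: "sets K = sets borel" and A: "A \<in> sets borel"
  shows "integrable K (\<lambda>x. measure M {a. a + x \<in> A})"
proof -
  interpret K: finite_measure K by fact
  show ?thesis
  proof (rule K.integrable_const_bound[where B = "measure M (space M)"])
    show "(\<lambda>x. measure M {a. a + x \<in> A}) \<in> borel_measurable K"
      using measurable_measure_translate[OF M sM A] sK measurable_cong_sets by blast
  qed (auto intro: finite_measure.bounded_measure[OF M])
qed

lemma measure_convolution:
  fixes M K :: "'a::ordered_euclidean_space measure"
  assumes M: "finite_measure M" and sM: "sets M = sets borel"
    and K: "finite_measure K" and sK: "sets K = sets borel" and A: "A \<in> sets borel"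
  shows "measure (M \<star> K) A = (\<integral>x. measure M {a. a + x \<in> A} \<partial>K)"
proof -
  have sp: "space M = UNIV" "space K = UNIV"
    using sets_eq_imp_space_eq[OF sM] sets_eq_imp_space_eq[OF sK] by simp_all
  have "emeasure (M \<star> K) A = emeasure (K \<star> M) A"
    using convolution_commutative[OF M K sK sM] by simp
  also have "\<dots> = (\<integral>\<^sup>+x. emeasure M {a. a + x \<in> A} \<partial>K)"
    by (rule convolution_emeasure[OF A K M sM sK]) (simp_all add: sp)
  also have "\<dots> = (\<integral>\<^sup>+x. ennreal (measure M {a. a + x \<in> A}) \<partial>K)"
    by (simp add: finite_measure.emeasure_eq_measure[OF M])
  finally have "measure (M \<star> K) A = enn2real (\<integral>\<^sup>+x. ennreal (measure M {a. a + x \<in> A}) \<partial>K)"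
    by (simp add: measure_def)
  also have "\<dots> = (\<integral>x. measure M {a. a + x \<in> A} \<partial>K)"
    using integrable_measure_translate[OF M sM K sK A]
    by (intro integral_eq_nn_integral[symmetric]) auto
  finally show ?thesis .
qed

lemma finite_convolution_jordan [simp]:
  fixes V W :: "'a::ordered_euclidean_space signed_measure"
  shows "finite_measure (jordan_pos V \<star> jordan_pos W)" "finite_measure (jordan_pos V \<star> jordan_neg W)"
    "finite_measure (jordan_neg V \<star> jordan_pos W)" "finite_measure (jordan_neg V \<star> jordan_neg W)"
  by (simp_all add: convolution_finite)

lift_definition of_measure :: "'a::topological_space measure \<Rightarrow> 'a signed_measure"
  is "\<lambda>M A. if finite_measure M \<and> sets M = sets borel then measure M A else 0"
proof -
  fix M :: "'a measure"
  show "countably_additive_real (\<lambda>A. if finite_measure M \<and> sets M = sets borel then measure M A else 0)"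
  proof (cases "finite_measure M \<and> sets M = sets borel")
    case True
    then show ?thesis
      using car_measure_diff[of M "null_measure M"] finite_measureI[of "null_measure M"] by simp
  next
    case False
    then show ?thesis by (simp only: countably_additive_real_def if_False) simp
  qed
qed

lemma smeasure_of_measure [simp]:
  "finite_measure M \<Longrightarrow> sets M = sets borel \<Longrightarrow> smeasure (of_measure M) A = measure M A"
  by transfer simp

lemma jordan_decomposition_of_measure: "V = of_measure (jordan_pos V) - of_measure (jordan_neg V)"
  by (rule signed_measure_eqI) (simp add: jordan_decomposition[of V])

lemma norm_of_measure:
  assumes M: "finite_measure M" and s: "sets M = sets borel"
  shows "norm (of_measure M) = measure M UNIV"
proof (rule antisym)
  let ?P = "hahn_set (of_measure M)"
  have "measure M ?P \<le> measure M (space M)" by (rule finite_measure.bounded_measure[OF M])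
  moreover have "space M = UNIV" using sets_eq_imp_space_eq[OF s] by simp
  ultimately show "norm (of_measure M) \<le> measure M UNIV"
    using measure_nonneg[of M "- ?P"]
      \<open>measure M ?P \<le> measure M (space M)\<close>[unfolded \<open>space M = UNIV\<close>]
    unfolding norm_hahn smeasure_of_measure[OF M s] by linarith
  show "measure M UNIV \<le> norm (of_measure M)"
    using abs_smeasure_le_norm[of "of_measure M" UNIV] M s by simp
qed

definition dirac :: "'a::topological_space \<Rightarrow> 'a signed_measure" where
  "dirac x = of_measure (return borel x)"

lemma smeasure_dirac: "smeasure (dirac x) A = (if A \<in> sets borel then indicator A x else 0)"
proof -
  have "finite_measure (return borel x)"
    by (intro prob_space.finite_measure prob_space_return) simp
  then show ?thesis
    by (auto simp: dirac_def measure_return measure_notin_sets)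
qed

instantiation signed_measure :: (ordered_euclidean_space) "{times, one}"
begin

text \<open>Convolution of signed measures is the bilinear extension of the convolution of finite
  positive measures.\<close>

definition times_signed_measure :: "'a signed_measure \<Rightarrow> 'a signed_measure \<Rightarrow> 'a signed_measure" where
  "V * W =
     (of_measure (jordan_pos V \<star> jordan_pos W) - of_measure (jordan_pos V \<star> jordan_neg W)) -
     (of_measure (jordan_neg V \<star> jordan_pos W) - of_measure (jordan_neg V \<star> jordan_neg W))"

definition one_signed_measure :: "'a signed_measure" where
  "1 = dirac 0"

instance ..

end

lemma smeasure_times:
  "smeasure (V * W) A =
     (measure (jordan_pos V \<star> jordan_pos W) A - measure (jordan_pos V \<star> jordan_neg W) A) -
     (measure (jordan_neg V \<star> jordan_pos W) A - measure (jordan_neg V \<star> jordan_neg W) A)"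
  by (simp add: times_signed_measure_def)

lemma signed_measure_mult_commute: "V * W = W * V" for V W :: "'a::ordered_euclidean_space signed_measure"
proof (rule signed_measure_eqI)
  fix A :: "'a set"
  have "(jordan_pos V \<star> jordan_pos W) = (jordan_pos W \<star> jordan_pos V)"
    "(jordan_pos V \<star> jordan_neg W) = (jordan_neg W \<star> jordan_pos V)"
    "(jordan_neg V \<star> jordan_pos W) = (jordan_pos W \<star> jordan_neg V)"
    "(jordan_neg V \<star> jordan_neg W) = (jordan_neg W \<star> jordan_neg V)"
    by (rule convolution_commutative; simp)+
  then show "smeasure (V * W) A = smeasure (W * V) A"
    by (simp add: smeasure_times)
qed

lemma integrable_smeasure_translate:
  fixes V :: "'a::ordered_euclidean_space signed_measure"
  assumes "finite_measure K" "sets K = sets borel" "A \<in> sets borel"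
  shows "integrable K (\<lambda>x. smeasure V {a. a + x \<in> A})"
  unfolding jordan_decomposition[of V] using assms
  by (intro Bochner_Integration.integrable_diff integrable_measure_translate) simp_all

theorem smeasure_times_integral:
  fixes V W :: "'a::ordered_euclidean_space signed_measure"
  assumes A: "A \<in> sets borel"
  shows "smeasure (V * W) A =
    (\<integral>x. smeasure V {a. a + x \<in> A} \<partial>jordan_pos W) - (\<integral>x. smeasure V {a. a + x \<in> A} \<partial>jordan_neg W)"
proof -
  have "(\<integral>x. smeasure V {a. a + x \<in> A} \<partial>K) = measure (jordan_pos V \<star> K) A - measure (jordan_neg V \<star> K) A"
    if K: "finite_measure K" "sets K = sets borel" for K
  proof -
    have "(\<integral>x. smeasure V {a. a + x \<in> A} \<partial>K) =
        (\<integral>x. measure (jordan_pos V) {a. a + x \<in> A} - measure (jordan_neg V) {a. a + x \<in> A} \<partial>K)"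
      by (simp add: jordan_decomposition[of V])
    also have "\<dots> = (\<integral>x. measure (jordan_pos V) {a. a + x \<in> A} \<partial>K)
        - (\<integral>x. measure (jordan_neg V) {a. a + x \<in> A} \<partial>K)"
      using K A by (intro Bochner_Integration.integral_diff integrable_measure_translate) simp_all
    finally show ?thesis using K A by (simp add: measure_convolution)
  qed
  then show ?thesis by (simp add: smeasure_times)
qed

lemma signed_measure_distrib_right: "(U + V) * W = U * W + V * W"
  for U V W :: "'a::ordered_euclidean_space signed_measure"
  by (rule signed_measure_eqI) (simp add: smeasure_times_integral integrable_smeasure_translate)

lemma signed_measure_scaleR_left: "(c *\<^sub>R V) * W = c *\<^sub>R (V * W)"
  for V W :: "'a::ordered_euclidean_space signed_measure"
  by (rule signed_measure_eqI) (simp add: smeasure_times_integral right_diff_distrib)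

lemma signed_measure_diff_left: "(U - V) * W = U * W - V * W"
  for U V W :: "'a::ordered_euclidean_space signed_measure"
  using signed_measure_distrib_right[of "U - V" V W] by (simp add: eq_diff_eq)

lemma signed_measure_diff_right: "W * (U - V) = W * U - W * V"
  for U V W :: "'a::ordered_euclidean_space signed_measure"
  using signed_measure_diff_left[of U V W] by (simp add: signed_measure_mult_commute)

theorem of_measure_mult:
  fixes M N :: "'a::ordered_euclidean_space measure"
  assumes M: "finite_measure M" "sets M = sets borel" and N: "finite_measure N" "sets N = sets borel"
  shows "of_measure M * of_measure N = of_measure (M \<star> N)"
proof (rule signed_measure_eqI)
  fix A :: "'a set" assume A: "A \<in> sets borel"
  let ?P = "jordan_pos (of_measure N)" and ?N = "jordan_neg (of_measure N)"
  have "smeasure (of_measure M * of_measure N) A = measure (M \<star> ?P) A - measure (M \<star> ?N) A"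
    using M by (simp add: smeasure_times_integral[OF A] measure_convolution A)
  also have "\<dots> = measure (?P \<star> M) A - measure (?N \<star> M) A"
    using M by (simp add: convolution_commutative[of M])
  also have "\<dots> = (\<integral>x. measure ?P {a. a + x \<in> A} - measure ?N {a. a + x \<in> A} \<partial>M)"
    using M A by (simp add: measure_convolution integrable_measure_translate)
  also have "\<dots> = (\<integral>x. measure N {a. a + x \<in> A} \<partial>M)"
    using N by (simp flip: jordan_decomposition)
  also have "\<dots> = measure (M \<star> N) A"
    using M N A by (simp add: measure_convolution convolution_commutative[of M N])
  finally show "smeasure (of_measure M * of_measure N) A = smeasure (of_measure (M \<star> N)) A"
    using M N by (simp add: convolution_finite)
qed

lemma signed_measure_mult_assoc: "(U * V) * W = U * (V * W)"
  for U V W :: "'a::ordered_euclidean_space signed_measure"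
proof -
  have *: "(of_measure K * of_measure L) * of_measure M = of_measure K * (of_measure L * of_measure M)"
    if "finite_measure K" "sets K = sets borel" "finite_measure L" "sets L = sets borel"
       "finite_measure M" "sets M = sets borel" for K L M :: "'a measure"
    using that by (simp add: of_measure_mult convolution_finite convolution_associative)
  show ?thesis
    apply (subst (1 2) jordan_decomposition_of_measure[of U])
    apply (subst (1 2) jordan_decomposition_of_measure[of V])
    apply (subst (1 2) jordan_decomposition_of_measure[of W])
    apply (simp add: signed_measure_diff_left signed_measure_diff_right *)
    done
qed

theorem dirac_mult_dirac: "dirac x * dirac y = dirac (x + y)"
  for x y :: "'a::ordered_euclidean_space"
proof -
  have f: "finite_measure (return borel z)" for z :: 'a
    by (intro prob_space.finite_measure prob_space_return) simp
  have "(return borel x \<star> return borel y) = return borel (x + y)"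
  proof (rule measure_eqI)
    fix A assume "A \<in> sets (return borel x \<star> return borel y)"
    then have A: "A \<in> sets borel" by simp
    have m: "(\<lambda>u. indicator A (u + y) :: ennreal) \<in> borel_measurable borel"
      "(\<lambda>v. indicator A (u + v) :: ennreal) \<in> borel_measurable borel" for u :: 'a
      using A by measurable
    show "emeasure (return borel x \<star> return borel y) A = emeasure (return borel (x + y)) A"
      using A by (simp add: convolution_emeasure' f nn_integral_return m)
  qed simp
  then show ?thesis by (simp add: dirac_def of_measure_mult f)
qed

lemma signed_measure_mult_1: "1 * V = V" for V :: "'a::ordered_euclidean_space signed_measure"
proof (rule signed_measure_eqI)
  fix A :: "'a set" assume A: "A \<in> sets borel"
  have f: "finite_measure (return borel (0::'a))"
    by (intro prob_space.finite_measure prob_space_return) simp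
  have "smeasure (of_measure M * 1) A = measure M A"
    if M: "finite_measure M" "sets M = sets borel" for M
  proof -
    have "(\<lambda>x. measure M {a. a + x \<in> A}) \<in> borel_measurable borel"
      by (rule measurable_measure_translate[OF M A])
    then have "measure (M \<star> return borel 0) A = measure M A"
      by (simp add: measure_convolution[OF M f _ A] integral_return)
    then show ?thesis
      using M f by (simp add: one_signed_measure_def dirac_def of_measure_mult convolution_finite)
  qed
  then have "smeasure ((of_measure (jordan_pos V) - of_measure (jordan_neg V)) * 1) A = smeasure V A"
    by (simp add: signed_measure_diff_left jordan_decomposition[of V])
  then show "smeasure (1 * V) A = smeasure V A"
    by (simp add: signed_measure_mult_commute[of 1] flip: jordan_decomposition_of_measure)
qed

instance signed_measure :: (ordered_euclidean_space) comm_ring_1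
proof
  fix a b c :: "'a signed_measure"
  show "a * b * c = a * (b * c)" by (rule signed_measure_mult_assoc)
  show "a * b = b * a" by (rule signed_measure_mult_commute)
  show "1 * a = a" by (rule signed_measure_mult_1)
  show "(a + b) * c = a * c + b * c" by (rule signed_measure_distrib_right)
  have "smeasure (1 :: 'a signed_measure) UNIV \<noteq> smeasure 0 UNIV"
    unfolding one_signed_measure_def by (simp add: smeasure_dirac)
  then show "(0 :: 'a signed_measure) \<noteq> 1" by metis
qed

lemma norm_dirac [simp]: "norm (dirac x) = 1"
  by (subst dirac_def, subst norm_of_measure)
     (auto intro!: prob_space.finite_measure prob_space_return simp: measure_return)

instance signed_measure :: (ordered_euclidean_space) real_normed_algebra_1
proof
  fix V W :: "'a signed_measure" and c :: real
  show "c *\<^sub>R V * W = c *\<^sub>R (V * W)" by (rule signed_measure_scaleR_left)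
  then show "V * c *\<^sub>R W = c *\<^sub>R (V * W)"
    using signed_measure_scaleR_left[of c W V] by (simp add: mult.commute)
  show "norm (1 :: 'a signed_measure) = 1" by (simp add: one_signed_measure_def)
  have n: "norm (of_measure (M \<star> N)) = measure M UNIV * measure N UNIV"
    if M: "finite_measure M" "sets M = sets borel" and N: "finite_measure N" "sets N = sets borel"
    for M N :: "'a measure"
  proof -
    have "measure (M \<star> N) UNIV = (\<integral>x. measure M UNIV \<partial>N)"
      using measure_convolution[OF M N, of UNIV] by simp
    also have "space N = UNIV" using sets_eq_imp_space_eq[OF N(2)] by simp
    then have "(\<integral>x. measure M UNIV \<partial>N) = measure M UNIV * measure N UNIV"
      by simp
    finally show ?thesis using M N by (simp add: norm_of_measure convolution_finite)
  qed
  let ?V = "jordan_pos V" and ?V' = "jordan_neg V" and ?W = "jordan_pos W" and ?W' = "jordan_neg W"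
  have "norm (V * W) \<le>
      (norm (of_measure (?V \<star> ?W)) + norm (of_measure (?V \<star> ?W'))) +
      (norm (of_measure (?V' \<star> ?W)) + norm (of_measure (?V' \<star> ?W')))"
    unfolding times_signed_measure_def
    by (intro order_trans[OF norm_triangle_ineq4] add_mono norm_triangle_ineq4)
  also have "\<dots> = norm V * norm W"
    by (simp only: n finite_jordan sets_jordan) (simp add: norm_signed_measure_def algebra_simps)
  finally show "norm (V * W) \<le> norm V * norm W" .
qed

section \<open>Poisson distribution\<close>

definition Po :: "real \<Rightarrow> real signed_measure" where
  "Po t = exp (t *\<^sub>R (dirac 1 - dirac 0))"

text \<open>The convention that 1/0 is infinite is that of \<^typ>\<open>ereal\<close>.\<close>

definition min_recip_one :: "real \<Rightarrow> real" where
  "min_recip_one t = real_of_ereal (min (1 / ereal t) 1)"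

lemma min_recip_one_eq: "min_recip_one t = (if t = 0 then 1 else min (1 / t) 1)"
  by (auto simp: min_recip_one_def one_ereal_def min_def)

lemma exp_signed_measure: "exp V = (\<Sum>m. V ^ m /\<^sub>R fact m)"
  for V :: "'a::ordered_euclidean_space signed_measure"
  by (simp add: exp_def)

end

theory Submission
  imports Defs
begin

text \<open>The linear map that adds the coordinates in \<open>J\<close> pushes \<open>F\<close> and \<open>G\<close> forward to the
  Poisson binomial and the Poisson law of the middle term, and pushing forward does not increase the
  total variation norm. In one dimension the norm dominates the Fourier transform at each \<open>t\<close>, and it
  suffices to compare moduli there: with \<open>c = 1 - cos t\<close> the transform of the Poisson law has modulus
  \<open>exp (- \<lambda> c)\<close>, and that of the Bernoulli convolution is at least
  \<open>exp (- \<lambda> c) * (1 + c * (1 - c) * (\<Sum>j. p\<^sub>j\<^sup>2))\<close>. The choice \<open>c = 2/5 * min (1/\<lambda>) 1\<close> gives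
  the constant \<open>6/25 * exp (-2/5) \<ge> 6/25 * 3/5 > 1/7\<close>.\<close>

section \<open>Linear maps that turn convolution factors into factors\<close>

text \<open>By linearity it is enough to treat positive measures, for which convolution with a point
  mass is a translation.\<close>

lemma smeasure_mult_dirac:
  fixes V :: "'a::ordered_euclidean_space signed_measure"
  assumes A: "A \<in> sets borel"
  shows "smeasure (V * dirac a) A = smeasure V {b. b + a \<in> A}"
proof -
  have f: "finite_measure (return borel a)"
    by (intro prob_space.finite_measure prob_space_return) simp
  have "smeasure (of_measure M * dirac a) A = measure M {b. b + a \<in> A}"
    if M: "finite_measure M" "sets M = sets borel" for M
  proof -
    have "measure (M \<star> return borel a) A = measure M {b. b + a \<in> A}"
      using measurable_measure_translate[OF M A]
      by (simp add: measure_convolution[OF M f _ A] integral_return)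
    then show ?thesis
      using M f by (simp add: dirac_def of_measure_mult convolution_finite)
  qed
  then have "smeasure ((of_measure (jordan_pos V) - of_measure (jordan_neg V)) * dirac a) A
      = smeasure V {b. b + a \<in> A}"
    by (simp add: left_diff_distrib jordan_decomposition[of V])
  then show ?thesis
    by (simp flip: jordan_decomposition_of_measure)
qed

text \<open>Multiplicativity is asked only for the factor \<open>U\<close>: it yields all powers of
  \<open>U\<close> starting from 1, and continuity carries it through the series. So it is enough to
  know how \<open>push f\<close> and \<open>atomic_fourier t\<close> act on products with Dirac
  measures.\<close>

lemma bounded_linear_exp:
  fixes \<Phi> :: "'a::{real_normed_algebra_1,banach,comm_ring_1}
      \<Rightarrow> 'b::{real_normed_algebra_1,banach,comm_ring_1}"
  assumes \<Phi>: "bounded_linear \<Phi>" and one: "\<Phi> 1 = 1" and U: "\<And>V. \<Phi> (V * U) = \<Phi> V * u"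
  shows "\<Phi> (exp U) = exp u"
proof -
  interpret bounded_linear \<Phi> by fact
  \<comment> \<open>\<open>power_Suc2\<close> puts the new factor on the right, where the hypothesis
    on \<open>U\<close> expects it.\<close>
  have "\<Phi> (U ^ m) = u ^ m" for m
    by (induction m) (simp_all add: one U power_Suc2 del: power_Suc)
  then show ?thesis
    unfolding exp_def by (subst suminf[OF summable_exp_generic]) (simp add: scaleR)
qed

text \<open>Multiplying a partial product \<open>X\<close> by \<open>1 + U j\<close> gives
  \<open>X + X * U j\<close>, so linearity and the rule for \<open>U j\<close> peel off one factor
  at a time.\<close>

lemma linear_prod_one_plus:
  fixes \<Phi> :: "'a::{real_algebra_1,comm_ring_1} \<Rightarrow> 'b::{real_algebra_1,comm_ring_1}"
  assumes \<Phi>: "linear \<Phi>" and one: "\<Phi> 1 = 1"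
    and U: "\<And>V j. j \<in> I \<Longrightarrow> \<Phi> (V * U j) = \<Phi> V * u j" and I: "finite I"
  shows "\<Phi> (\<Prod>j\<in>I. 1 + U j) = (\<Prod>j\<in>I. 1 + u j)"
  using I U
proof (induction I)
  case (insert j I)
  then show ?case
    by (simp add: distrib_right linear_add[OF \<Phi>] mult.commute[of "U j"] mult.commute[of "u j"])
qed (simp add: one)


section \<open>Pushforward\<close>

text \<open>The value 0 for a non-measurable \<open>f\<close> makes this a signed measure for every
  \<open>f\<close>; the value 0 off the Borel sets is the convention for all set functions
  here.\<close>

lift_definition push ::
    "('a::topological_space \<Rightarrow> 'b::topological_space) \<Rightarrow> 'a signed_measure \<Rightarrow> 'b signed_measure"
  is "\<lambda>f V A. if f \<in> borel_measurable borel \<and> A \<in> sets borel then V (f -` A) else 0"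
proof -
  fix f :: "'a \<Rightarrow> 'b" and V :: "'a set \<Rightarrow> real"
  assume V: "countably_additive_real V"
  show "countably_additive_real
      (\<lambda>A. if f \<in> borel_measurable borel \<and> A \<in> sets borel then V (f -` A) else 0)"
  proof (cases "f \<in> borel_measurable borel")
    case True
    show ?thesis
      unfolding countably_additive_real_def
    proof (intro conjI allI impI)
      fix X :: "nat \<Rightarrow> 'b set"
      assume X: "range X \<subseteq> sets borel" and d: "disjoint_family X"
      have "(\<lambda>i. V (f -` X i)) sums V (\<Union>i. f -` X i)"
        using X d measurable_sets[OF True]
        by (intro car_sums[OF V]) (auto simp: disjoint_family_on_def)
      moreover have "(\<Union>i. X i) \<in> sets borel" using X by blast
      ultimately show "(\<lambda>i. if f \<in> borel_measurable borel \<and> X i \<in> sets borel then V (f -` X i) else 0)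
          sums (if f \<in> borel_measurable borel \<and> (\<Union>i. X i) \<in> sets borel then V (f -` (\<Union>i. X i)) else 0)"
        using True X by (simp add: vimage_UN range_subsetD)
    qed simp
  qed (simp add: countably_additive_real_def)
qed

lemma smeasure_push:
  "f \<in> borel_measurable borel \<Longrightarrow> A \<in> sets borel \<Longrightarrow> smeasure (push f V) A = smeasure V (f -` A)"
  by transfer simp

text \<open>The preimage of a Hahn set of the image is one of the Borel sets against which the norm
  of \<open>V\<close> can be tested.\<close>

lemma norm_push_le:
  assumes f: "f \<in> borel_measurable borel"
  shows "norm (push f V) \<le> norm V"
proof -
  let ?H = "hahn_set (push f V)"
  have "f -` ?H \<in> sets borel" using measurable_sets[OF f, of ?H] by simp
  then have "smeasure V (f -` ?H) - smeasure V (- (f -` ?H)) \<le> norm V"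
    by (rule norm_smeasure_ge)
  then show ?thesis
    by (simp add: norm_hahn[of "push f V"] smeasure_push f borel_comp vimage_Compl)
qed

lemma bounded_linear_push:
  assumes f: "f \<in> borel_measurable borel"
  shows "bounded_linear (push f)"
proof (rule bounded_linear_intro[where K = 1])
  show "push f (V + W) = push f V + push f W" "push f (c *\<^sub>R V) = c *\<^sub>R push f V" for V W c
    by (rule signed_measure_eqI, simp add: smeasure_push f)+
qed (simp add: norm_push_le f)

lemma push_dirac:
  assumes f: "f \<in> borel_measurable borel"
  shows "push f (dirac x) = dirac (f x)"
proof (rule signed_measure_eqI)
  fix A :: "'b set" assume "A \<in> sets borel"
  then show "smeasure (push f (dirac x)) A = smeasure (dirac (f x)) A"
    using measurable_sets[OF f, of A]
    by (simp add: smeasure_push f smeasure_dirac indicator_def)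
qed

text \<open>Additivity lets the shift by \<open>x\<close> pass through \<open>f\<close> as a shift
  by \<open>f x\<close>.\<close>

lemma push_mult_dirac:
  fixes f :: "'a::ordered_euclidean_space \<Rightarrow> 'b::ordered_euclidean_space"
  assumes f: "f \<in> borel_measurable borel" and add: "\<And>x y. f (x + y) = f x + f y"
  shows "push f (V * dirac x) = push f V * dirac (f x)"
proof (rule signed_measure_eqI)
  fix A :: "'b set" assume A: "A \<in> sets borel"
  have "(\<lambda>b. b + f x) \<in> borel_measurable borel" by measurable
  from measurable_sets[OF this A]
  have "{b. b + f x \<in> A} \<in> sets borel" by (simp add: vimage_def)
  then show "smeasure (push f (V * dirac x)) A = smeasure (push f V * dirac (f x)) A"
    using A measurable_sets[OF f A]
    by (simp add: smeasure_push f smeasure_mult_dirac add vimage_def)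
qed


section \<open>Fourier transform\<close>

text \<open>This is the transform of the atomic part only; all measures it is applied to are atomic.\<close>

definition atomic_fourier :: "real \<Rightarrow> real signed_measure \<Rightarrow> complex" where
  "atomic_fourier t V = (\<Sum>\<^sub>\<infinity>x. smeasure V {x} *\<^sub>R cis (t * x))"

text \<open>Each atom is bounded by its masses under the two Jordan parts, and these add up over
  \<open>S\<close>. The bound is uniform in \<open>S\<close>, so the sum over all reals converges
  absolutely.\<close>

lemma sum_abs_atoms_le_norm:
  assumes S: "finite (S :: real set)"
  shows "(\<Sum>x\<in>S. \<bar>smeasure V {x}\<bar>) \<le> norm V"
proof -
  let ?P = "jordan_pos V" and ?N = "jordan_neg V"
  interpret P: finite_measure ?P by simp
  interpret N: finite_measure ?N by simp
  have "(\<Sum>x\<in>S. \<bar>smeasure V {x}\<bar>) \<le> (\<Sum>x\<in>S. measure ?P {x} + measure ?N {x})"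
    by (rule sum_mono) (smt (verit) jordan_decomposition measure_nonneg)
  also have "\<dots> = measure ?P S + measure ?N S"
    using P.finite_measure_eq_sum_singleton[OF S] N.finite_measure_eq_sum_singleton[OF S]
    by (simp add: sum.distrib)
  also have "\<dots> \<le> norm V"
    unfolding norm_signed_measure_def
    using P.bounded_measure[of S] N.bounded_measure[of S] by simp
  finally show ?thesis .
qed

lemma abs_summable_atoms: "(\<lambda>x. norm (smeasure V {x} *\<^sub>R cis (t * x))) summable_on UNIV"
  by (rule nonneg_bdd_above_summable_on)
     (auto intro!: bdd_aboveI2[where M = "norm V"] sum_abs_atoms_le_norm)

lemma summable_atoms: "(\<lambda>x. smeasure V {x} *\<^sub>R cis (t * x)) summable_on UNIV"
  using abs_summable_atoms by (rule abs_summable_summable)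

lemma norm_atomic_fourier_le: "norm (atomic_fourier t V) \<le> norm V"
proof -
  have "norm (atomic_fourier t V) \<le> (\<Sum>\<^sub>\<infinity>x. norm (smeasure V {x} *\<^sub>R cis (t * x)))"
    unfolding atomic_fourier_def by (rule norm_infsum_bound[OF abs_summable_atoms])
  also have "\<dots> \<le> norm V"
    by (rule infsum_le_finite_sums[OF abs_summable_atoms]) (simp add: sum_abs_atoms_le_norm)
  finally show ?thesis .
qed

lemma bounded_linear_atomic_fourier: "bounded_linear (atomic_fourier t)"
proof (rule bounded_linear_intro[where K = 1])
  show "atomic_fourier t (V + W) = atomic_fourier t V + atomic_fourier t W" for V W
    unfolding atomic_fourier_def
    by (simp add: scaleR_left_distrib infsum_add[OF summable_atoms summable_atoms])
  show "atomic_fourier t (c *\<^sub>R V) = c *\<^sub>R atomic_fourier t V" for c V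
    unfolding atomic_fourier_def by (simp flip: infsum_scaleR_right)
qed (simp add: norm_atomic_fourier_le)

lemma atomic_fourier_mult_dirac:
  "atomic_fourier t (V * dirac a) = atomic_fourier t V * cis (t * a)"
proof -
  have eq: "{b. b + a = x} = {x - a}" for x by auto
  have "atomic_fourier t (V * dirac a) = (\<Sum>\<^sub>\<infinity>x. smeasure V {x - a} *\<^sub>R cis (t * x))"
    unfolding atomic_fourier_def by (simp add: smeasure_mult_dirac eq)
  also have "\<dots> = (\<Sum>\<^sub>\<infinity>y. smeasure V {y} *\<^sub>R cis (t * (y + a)))"
    by (rule infsum_reindex_bij_witness[where i = "\<lambda>y. y + a" and j = "\<lambda>x. x - a"]) auto
  also have "\<dots> = (\<Sum>\<^sub>\<infinity>y. smeasure V {y} *\<^sub>R cis (t * y) * cis (t * a))"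
    by (simp add: distrib_left cis_mult)
  also have "\<dots> = atomic_fourier t V * cis (t * a)"
    unfolding atomic_fourier_def by (rule infsum_cmult_left) (rule summable_atoms)
  finally show ?thesis .
qed

lemma atomic_fourier_1: "atomic_fourier t 1 = 1"
proof -
  have "atomic_fourier t 1 = (\<Sum>\<^sub>\<infinity>x\<in>{0}. smeasure 1 {x} *\<^sub>R cis (t * x))"
    unfolding atomic_fourier_def one_signed_measure_def
    by (rule infsum_cong_neutral) (auto simp: smeasure_dirac)
  then show ?thesis by (simp add: one_signed_measure_def smeasure_dirac)
qed


section \<open>The one-dimensional lower bound\<close>

lemma norm_one_plus_cis:
  "(norm (1 + p *\<^sub>R (cis t - 1)))\<^sup>2 = 1 - 2 * p * (1 - p) * (1 - cos t)"
proof -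
  have "(norm (1 + p *\<^sub>R (cis t - 1)))\<^sup>2 = (1 + p * (cos t - 1))\<^sup>2 + p\<^sup>2 * (1 - (cos t)\<^sup>2)"
    by (simp add: cmod_power2 power_mult_distrib sin_squared_eq)
  also have "\<dots> = 1 - 2 * p * (1 - p) * (1 - cos t)"
    by (simp add: algebra_simps power2_eq_square)
  finally show ?thesis .
qed

text \<open>For \<open>c = 1 - cos t\<close> the right side is the squared modulus of a Bernoulli
  transform. After multiplication by \<open>exp (2 * p * c)\<close>, the exponential may be replaced
  by its quadratic Taylor polynomial, a lower bound for nonnegative arguments.\<close>

lemma bernoulli_factor_ge:
  fixes p c :: real
  assumes p: "0 \<le> p" "p \<le> 1" and c: "0 \<le> c" "c \<le> 1"
  shows "(exp (- (p * c)) * (1 + p\<^sup>2 * (c * (1 - c))))\<^sup>2 \<le> 1 - 2 * p * (1 - p) * c"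
proof -
  have a: "0 \<le> 1 - 2 * p * (1 - p) * c"
  proof -
    have "2 * (p * (1 - p)) \<le> 1"
      using zero_le_power2[of "2 * p - 1"] zero_le_power2[of p]
      by (simp add: power2_eq_square algebra_simps)
    then have "2 * (p * (1 - p)) * c \<le> 1 * 1" using c by (intro mult_mono) auto
    then show ?thesis by (simp add: algebra_simps)
  qed
  have "(1 + p\<^sup>2 * (c * (1 - c)))\<^sup>2
      \<le> (1 - 2 * p * (1 - p) * c) * (1 + 2 * p * c + (2 * p * c)\<^sup>2 / 2)"
  proof -
    \<comment> \<open>The only negative term in the difference of the two sides is absorbed because
      \<open>p * (1 - c)\<close> is at most 1.\<close>
    have "p ^ 3 * c\<^sup>2 * (1 - c) * (p * (1 - c)) \<le> p ^ 3 * c\<^sup>2 * (1 - c) * (1 * 1)"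
      using p c by (intro mult_left_mono mult_mono) auto
    moreover have "0 \<le> p ^ 3 * c\<^sup>2 * (1 - c)" "0 \<le> p ^ 4 * c ^ 3" using p c by auto
    moreover have "(1 - 2 * p * (1 - p) * c) * (1 + 2 * p * c + (2 * p * c)\<^sup>2 / 2)
        - (1 + p\<^sup>2 * (c * (1 - c)))\<^sup>2
        = 4 * (p ^ 3 * c\<^sup>2 * (1 - c)) + 4 * (p ^ 4 * c ^ 3) - p ^ 3 * c\<^sup>2 * (1 - c) * (p * (1 - c))"
      by (simp add: field_simps power2_eq_square power3_eq_cube power4_eq_xxxx)
    ultimately show ?thesis by linarith
  qed
  also have "\<dots> \<le> (1 - 2 * p * (1 - p) * c) * exp (2 * p * c)"
    using p c a by (intro mult_left_mono exp_lower_Taylor_quadratic) auto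
  finally have "(exp (- (p * c)))\<^sup>2 * (1 + p\<^sup>2 * (c * (1 - c)))\<^sup>2
      \<le> (exp (- (p * c)))\<^sup>2 * ((1 - 2 * p * (1 - p) * c) * exp (2 * p * c))"
    by (intro mult_left_mono) auto
  also have "\<dots> = 1 - 2 * p * (1 - p) * c"
    by (simp add: power2_eq_square mult.assoc flip: exp_add)
  finally show ?thesis by (simp add: power_mult_distrib)
qed

lemma one_plus_sum_le_prod:
  fixes a :: "'i \<Rightarrow> real"
  assumes "\<And>i. i \<in> I \<Longrightarrow> 0 \<le> a i"
  shows "1 + (\<Sum>i\<in>I. a i) \<le> (\<Prod>i\<in>I. 1 + a i)"
  using assms
proof (induction I rule: infinite_finite_induct)
  case (insert i I)
  have "(1 + a i) * (1 + sum a I) \<le> (1 + a i) * (\<Prod>i\<in>I. 1 + a i)"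
    using insert by (intro mult_left_mono) auto
  moreover have "0 \<le> a i * sum a I" using insert by (intro mult_nonneg_nonneg sum_nonneg) auto
  ultimately show ?case using insert by (simp add: algebra_simps)
qed auto

text \<open>The frequency enters only through \<open>c\<close>, which stays free here and is chosen
  in the next theorem.\<close>

lemma norm_bernoulli_poisson_ge_fourier:
  fixes p :: "'i \<Rightarrow> real"
  assumes I: "finite I" and p: "\<And>j. j \<in> I \<Longrightarrow> p j \<in> {0..1}" and c: "0 \<le> c" "c \<le> 1"
  shows "norm ((\<Prod>j\<in>I. dirac 0 + p j *\<^sub>R (dirac 1 - dirac 0)) - Po (\<Sum>j\<in>I. p j))
    \<ge> exp (- ((\<Sum>j\<in>I. p j) * c)) * (c * (1 - c) * (\<Sum>j\<in>I. (p j)\<^sup>2))"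
proof -
  define t where "t = arccos (1 - c)"
  have t: "1 - cos t = c" using c by (simp add: t_def cos_arccos)
  let ?\<Phi> = "atomic_fourier t"
  interpret \<Phi>: bounded_linear ?\<Phi> by (rule bounded_linear_atomic_fourier)
  have U: "?\<Phi> (V * (a *\<^sub>R (dirac 1 - dirac 0))) = ?\<Phi> V * (a *\<^sub>R (cis t - 1))" for V a
    by (simp add: right_diff_distrib \<Phi>.diff \<Phi>.scaleR atomic_fourier_mult_dirac)
  define F where "F = (\<Prod>j\<in>I. dirac 0 + p j *\<^sub>R (dirac 1 - dirac 0 :: real signed_measure))"
  have \<Phi>F: "?\<Phi> F = (\<Prod>j\<in>I. 1 + p j *\<^sub>R (cis t - 1))"
    unfolding F_def one_signed_measure_def[symmetric]
    by (rule linear_prod_one_plus[OF \<Phi>.linear_axioms atomic_fourier_1 _ I])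
       (use U in \<open>simp add: one_signed_measure_def\<close>)
  have "?\<Phi> (Po l) = exp (l *\<^sub>R (cis t - 1))" for l
    unfolding Po_def by (rule bounded_linear_exp[OF \<Phi>.bounded_linear_axioms atomic_fourier_1 U])
  \<comment> \<open>The modulus of a complex exponential is the exponential of the real part, here
    \<open>l * (cos t - 1)\<close>.\<close>
  then have \<Phi>G: "norm (?\<Phi> (Po l)) = exp (- (l * c))" for l
    by (simp add: t[symmetric] algebra_simps)
  have "exp (- ((\<Sum>j\<in>I. p j) * c)) * (1 + c * (1 - c) * (\<Sum>j\<in>I. (p j)\<^sup>2))
      = exp (- ((\<Sum>j\<in>I. p j) * c)) * (1 + (\<Sum>j\<in>I. (p j)\<^sup>2 * (c * (1 - c))))"
    by (simp add: sum_distrib_right[symmetric])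
  also have "\<dots> \<le> exp (- ((\<Sum>j\<in>I. p j) * c)) * (\<Prod>j\<in>I. 1 + (p j)\<^sup>2 * (c * (1 - c)))"
    using c by (intro mult_left_mono one_plus_sum_le_prod) auto
  \<comment> \<open>The Poisson modulus is split among the factors, so that each can be compared
    with one Bernoulli transform.\<close>
  also have "\<dots> = (\<Prod>j\<in>I. exp (- (p j * c)) * (1 + (p j)\<^sup>2 * (c * (1 - c))))"
    by (simp add: prod.distrib sum_distrib_right exp_sum[OF I] flip: sum_negf)
  also have "\<dots> \<le> (\<Prod>j\<in>I. norm (1 + p j *\<^sub>R (cis t - 1)))"
  proof (rule prod_mono)
    fix j assume "j \<in> I"
    then have "(exp (- (p j * c)) * (1 + (p j)\<^sup>2 * (c * (1 - c))))\<^sup>2 \<le> (norm (1 + p j *\<^sub>R (cis t - 1)))\<^sup>2"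
      unfolding norm_one_plus_cis t using p[of j] c by (intro bernoulli_factor_ge) auto
    then show "0 \<le> exp (- (p j * c)) * (1 + (p j)\<^sup>2 * (c * (1 - c))) \<and>
        exp (- (p j * c)) * (1 + (p j)\<^sup>2 * (c * (1 - c))) \<le> norm (1 + p j *\<^sub>R (cis t - 1))"
      using c by (auto dest: power2_le_imp_le)
  qed
  also have "\<dots> = norm (?\<Phi> F)" by (simp add: \<Phi>F prod_norm)
  \<comment> \<open>Subtracting the Poisson modulus removes exactly the summand 1.\<close>
  finally have "exp (- ((\<Sum>j\<in>I. p j) * c)) * (c * (1 - c) * (\<Sum>j\<in>I. (p j)\<^sup>2))
      \<le> norm (?\<Phi> F) - norm (?\<Phi> (Po (\<Sum>j\<in>I. p j)))"
    by (simp add: \<Phi>G distrib_left)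
  also have "\<dots> \<le> norm (?\<Phi> (F - Po (\<Sum>j\<in>I. p j)))"
    unfolding \<Phi>.diff by (rule norm_triangle_ineq2)
  also have "\<dots> \<le> norm (F - Po (\<Sum>j\<in>I. p j))" by (rule norm_atomic_fourier_le)
  finally show ?thesis unfolding F_def .
qed

theorem norm_bernoulli_poisson_ge:
  fixes p :: "'i \<Rightarrow> real"
  assumes I: "finite I" and p: "\<And>j. j \<in> I \<Longrightarrow> p j \<in> {0..1}"
  shows "norm ((\<Prod>j\<in>I. dirac 0 + p j *\<^sub>R (dirac 1 - dirac 0)) - Po (\<Sum>j\<in>I. p j))
    \<ge> 1/7 * min_recip_one (\<Sum>j\<in>I. p j) * (\<Sum>j\<in>I. (p j)\<^sup>2)"
proof -
  define l where "l = (\<Sum>j\<in>I. p j)"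
  define m where "m = min_recip_one l"
  have l: "0 \<le> l" using p by (auto simp: l_def intro!: sum_nonneg)
  have m: "0 \<le> m" "m \<le> 1" "l * m \<le> 1"
    using l by (auto simp: m_def min_recip_one_eq min_def field_simps)
  \<comment> \<open>Both \<open>l * c\<close> and \<open>c\<close> are then at most 2/5, so
    \<open>exp (- (l * c))\<close> and \<open>1 - c\<close> are each at least 3/5.\<close>
  define c where "c = 2/5 * m"
  have "3/5 \<le> 1 + - (l * c)" using m by (simp add: c_def)
  also have "\<dots> \<le> exp (- (l * c))" by (rule exp_ge_add_one_self)
  finally have e: "3/5 \<le> exp (- (l * c))" .
  \<comment> \<open>The constant on the right is 18/125, just above 1/7 since 7 * 18 = 126.\<close>
  have "1/7 * m \<le> 3/5 * (2/5 * m * (3/5))" using m by simp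
  also have "\<dots> \<le> exp (- (l * c)) * (c * (1 - c))"
    using e m by (intro mult_mono) (auto simp: c_def)
  finally have "1/7 * m * (\<Sum>j\<in>I. (p j)\<^sup>2) \<le> exp (- (l * c)) * (c * (1 - c)) * (\<Sum>j\<in>I. (p j)\<^sup>2)"
    by (intro mult_right_mono sum_nonneg) auto
  also have "\<dots> \<le> norm ((\<Prod>j\<in>I. dirac 0 + p j *\<^sub>R (dirac 1 - dirac 0)) - Po l)"
    unfolding l_def mult.assoc[of "exp _"] by (rule norm_bernoulli_poisson_ge_fourier[OF I p]) (use m in \<open>auto simp: c_def\<close>)
  finally show ?thesis by (simp add: m_def l_def)
qed


section \<open>Projection to one dimension\<close>

lemma norm_multivariate_ge_univariate:
  fixes p :: "'i \<Rightarrow> real" and q :: "'i \<Rightarrow> 'd::finite \<Rightarrow> real" and J :: "'d set"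
  assumes I: "finite I"
  defines "P \<equiv> \<lambda>j. p j * (\<Sum>r\<in>J. q j r)"
  shows "norm ((\<Prod>j\<in>I. dirac 0 + p j *\<^sub>R (\<Sum>r\<in>UNIV. q j r *\<^sub>R (dirac (axis r 1) - dirac 0)))
        - exp (\<Sum>r\<in>UNIV. (\<Sum>j\<in>I. p j * q j r) *\<^sub>R (dirac (axis r 1 :: real ^ 'd) - dirac 0)))
    \<ge> norm ((\<Prod>j\<in>I. dirac 0 + P j *\<^sub>R (dirac 1 - dirac 0)) - Po (\<Sum>j\<in>I. P j))"
proof -
  define f where "f x = (\<Sum>r\<in>J. x $ r)" for x :: "real ^ 'd"
  have fm: "f \<in> borel_measurable borel"
    unfolding f_def by (intro borel_measurable_continuous_onI continuous_intros)
  have f_add: "f (x + y) = f x + f y" for x y by (simp add: f_def sum.distrib)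
  have f_axis: "f (axis r 1) = (if r \<in> J then 1 else 0)" for r
    by (simp add: f_def axis_def sum.delta' if_distrib cong: if_cong)
  have f0: "f 0 = 0" by (simp add: f_def)
  interpret \<Phi>: bounded_linear "push f" by (rule bounded_linear_push[OF fm])
  have one: "push f 1 = 1" by (simp add: one_signed_measure_def push_dirac fm f0)
  let ?U = "\<lambda>a. \<Sum>r\<in>UNIV. a r *\<^sub>R (dirac (axis r 1 :: real ^ 'd) - dirac 0)"
  \<comment> \<open>This one rule serves each factor of the product, with \<open>a = q j\<close>,
    and the exponent of the exponential. Directions outside \<open>J\<close> are sent to 0, where
    the two Dirac measures cancel.\<close>
  have U: "push f (V * ?U a) = push f V * ((\<Sum>r\<in>J. a r) *\<^sub>R (dirac 1 - dirac 0))" for V a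
  proof -
    have "push f (V * ?U a) = (\<Sum>r\<in>UNIV. push f V * (a r *\<^sub>R (dirac (f (axis r 1)) - dirac 0)))"
      by (simp add: sum_distrib_left right_diff_distrib \<Phi>.sum \<Phi>.diff \<Phi>.scaleR
          push_mult_dirac[OF fm f_add] f0)
    also have "\<dots> = (\<Sum>r\<in>J. push f V * (a r *\<^sub>R (dirac 1 - dirac 0)))"
      by (rule sum.mono_neutral_cong_right) (auto simp: f_axis)
    finally show ?thesis by (simp add: sum_distrib_left scaleR_left.sum)
  qed
  have "push f (\<Prod>j\<in>I. dirac 0 + p j *\<^sub>R ?U (q j)) = (\<Prod>j\<in>I. dirac 0 + P j *\<^sub>R (dirac 1 - dirac 0))"
    unfolding one_signed_measure_def[symmetric]
    by (rule linear_prod_one_plus[OF \<Phi>.linear_axioms one _ I])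
       (use U in \<open>simp add: one_signed_measure_def \<Phi>.scaleR P_def\<close>)
  \<comment> \<open>Summing the intensities over \<open>J\<close> and then exchanging the two sums
    gives the Poisson mean.\<close>
  moreover have "push f (exp (?U (\<lambda>r. \<Sum>j\<in>I. p j * q j r))) = Po (\<Sum>j\<in>I. P j)"
    unfolding bounded_linear_exp[OF \<Phi>.bounded_linear_axioms one U] Po_def P_def sum_distrib_left
    by (subst sum.swap) simp
  ultimately show ?thesis
    using norm_push_le[OF fm] by (metis (no_types, lifting) \<Phi>.diff)
qed

theorem proposition1p3:
  fixes n :: nat
    and p :: "nat \<Rightarrow> real"
    and q :: "nat \<Rightarrow> 'd::finite \<Rightarrow> real"
    and lam :: real
    and lam_r :: "'d \<Rightarrow> real"
    and F G :: "(real ^ 'd) signed_measure"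
    and J :: "'d set"
    and y p_tilde :: "nat \<Rightarrow> real"
    and lam_tilde :: real
  assumes n: "n \<ge> 1"
    and p: "\<And>j. j \<in> {1..n} \<Longrightarrow> p j \<in> {0..1}"
    and q: "\<And>j r. j \<in> {1..n} \<Longrightarrow> q j r \<in> {0..1}"
    and q_sum: "\<And>j. j \<in> {1..n} \<Longrightarrow> (\<Sum>r\<in>UNIV. q j r) = 1"
    and lam_r: "\<And>r. lam_r r = (\<Sum>j=1..n. p j * q j r)"
    and lam_r_pos: "\<And>r. lam_r r > 0"
    and lam: "lam = (\<Sum>j=1..n. p j)"
    and F: "F = (\<Prod>j=1..n. dirac 0 + p j *\<^sub>R (\<Sum>r\<in>UNIV. q j r *\<^sub>R (dirac (axis r 1) - dirac 0)))"
    and G: "G = exp (\<Sum>r\<in>UNIV. lam_r r *\<^sub>R (dirac (axis r 1) - dirac 0))"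
    and y: "\<And>j. j \<in> {1..n} \<Longrightarrow> y j = (\<Sum>r\<in>J. q j r)"
    and p_tilde: "\<And>j. j \<in> {1..n} \<Longrightarrow> p_tilde j = p j * y j"
    and lam_tilde: "lam_tilde = (\<Sum>j=1..n. p_tilde j)"
  shows "norm (F - G)
           \<ge> norm ((\<Prod>j=1..n. dirac 0 + p_tilde j *\<^sub>R (dirac 1 - dirac 0)) - Po lam_tilde)
       \<and> norm ((\<Prod>j=1..n. dirac 0 + p_tilde j *\<^sub>R (dirac 1 - dirac 0)) - Po lam_tilde)
           \<ge> 1/7 * min_recip_one lam_tilde * (\<Sum>j=1..n. (p_tilde j)\<^sup>2)
       \<and> norm (F - G) \<ge> 1/7 * min_recip_one lam * (\<Sum>j=1..n. (p j)\<^sup>2)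
       \<and> norm (F - G) \<ge> 1/7 * (MAX r. min_recip_one (lam_r r) * (\<Sum>j=1..n. (p j)\<^sup>2 * (q j r)\<^sup>2))"
proof -
  \<comment> \<open>All claims are instances of this bound: \<open>K = J\<close> for the chain,
    \<open>K = UNIV\<close> and \<open>K = {r}\<close> for the two special cases.\<close>
  have key: "norm (F - G) \<ge> norm ((\<Prod>j=1..n. dirac 0 + P j *\<^sub>R (dirac 1 - dirac 0)) - Po (\<Sum>j=1..n. P j)) \<and>
      norm ((\<Prod>j=1..n. dirac 0 + P j *\<^sub>R (dirac 1 - dirac 0)) - Po (\<Sum>j=1..n. P j))
        \<ge> 1/7 * min_recip_one (\<Sum>j=1..n. P j) * (\<Sum>j=1..n. (P j)\<^sup>2)"
    if P: "\<And>j. j \<in> {1..n} \<Longrightarrow> P j = p j * (\<Sum>r\<in>K. q j r)" for P K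
  proof
    have "P j \<in> {0..1}" if j: "j \<in> {1..n}" for j
    proof -
      have "0 \<le> (\<Sum>r\<in>K. q j r)" using q[OF j] by (intro sum_nonneg) auto
      moreover have "(\<Sum>r\<in>K. q j r) \<le> (\<Sum>r\<in>UNIV. q j r)" using q[OF j] by (intro sum_mono2) auto
      ultimately show ?thesis using p[OF j] q_sum[OF j] by (auto simp: P[OF j] mult_le_one)
    qed
    then show "norm ((\<Prod>j=1..n. dirac 0 + P j *\<^sub>R (dirac 1 - dirac 0)) - Po (\<Sum>j=1..n. P j))
        \<ge> 1/7 * min_recip_one (\<Sum>j=1..n. P j) * (\<Sum>j=1..n. (P j)\<^sup>2)"
      by (intro norm_bernoulli_poisson_ge) auto
    show "norm (F - G) \<ge> norm ((\<Prod>j=1..n. dirac 0 + P j *\<^sub>R (dirac 1 - dirac 0)) - Po (\<Sum>j=1..n. P j))"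
      using norm_multivariate_ge_univariate[where I = "{1..n}" and p = p and q = q and J = K] unfolding F G lam_r by (simp add: P)
  qed
  \<comment> \<open>For \<open>K = UNIV\<close> the weights sum to 1, so \<open>P\<close> is
    \<open>p\<close> itself.\<close>
  have "1/7 * min_recip_one lam * (\<Sum>j=1..n. (p j)\<^sup>2) \<le> norm (F - G)"
    using key[of p UNIV] q_sum unfolding lam by auto
  moreover have "1/7 * (min_recip_one (lam_r r) * (\<Sum>j=1..n. (p j)\<^sup>2 * (q j r)\<^sup>2)) \<le> norm (F - G)" for r
    using key[of "\<lambda>j. p j * q j r" "{r}"] unfolding lam_r by (auto simp: power_mult_distrib)
  \<comment> \<open>The maximum over the finite index type is attained, so the bound for each single
    \<open>r\<close> is enough.\<close>
  then have "1/7 * (MAX r. min_recip_one (lam_r r) * (\<Sum>j=1..n. (p j)\<^sup>2 * (q j r)\<^sup>2)) \<le> norm (F - G)"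
    using Max_in[of "range (\<lambda>r. min_recip_one (lam_r r) * (\<Sum>j=1..n. (p j)\<^sup>2 * (q j r)\<^sup>2))"] by fastforce
  ultimately show ?thesis
    using key[of p_tilde J] p_tilde y unfolding lam_tilde by auto
qed

end
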